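(* Let $S \subseteq \mathbb{Z}^+$ be infinite, let $s\colon S \to \mathbb{N}$ be a stage function, let a linear order $\prec$ be given on each fiber of $s$, and let $T$ be the concatenation of the ordered fibers in increasing order of stage. Then $T$ avoids monotone $3$-term arithmetic progressions if and only if both of the following hold. (A) No AP triple $(x,y,z)$ in $S$ has strictly monotone stages, i.e. neither $s(x)<s(y)<s(z)$ nor $s(z)<s(y)<s(x)$. (B) For every AP triple $(x,y,z)$ in $S$ the fiber orders satisfy the forced pairs: if $s(x)<s(y)=s(z)$ then $z \prec y$; if $s(z)<s(y)=s(x)$ then $x \prec y$; if $s(x)=s(y)<s(z)$ then $y \prec x$; if $s(y)=s(z)<s(x)$ then $y \prec z$; and if $s(x)=s(y)=s(z)$ then the fiber order is non-monotone on the triple, i.e. neither $x \prec y \prec z$ nor $z \prec y \prec x$. (AP triples in which $s(x)$ and $s(z)$ are both strictly greater than $s(y)$, or both strictly less than $s(y)$, never occur monotonically in $T$.) Hence $S$ is $3$-permutable if and only if some stage function for $S$, together with some choice of linear orders on its fibers, satisfies (A) and (B). Moreover, for given $s$, condition (B) is a conjunction of independent conditions, one on the order of each (finite) fiber.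
   Context: $\mathbb{N} = \{1,2,3,\dots\} = \mathbb{Z}^+$. A stage function for an infinite set $S \subseteq \mathbb{Z}^+$ is any function $s\colon S \to \mathbb{N}$ all of whose fibers $s^{-1}(\sigma)$ are finite. Given $s$ and a linear order on each fiber, the concatenation $T$ is the arrangement of $S$ in which $u$ comes before $v$ iff $s(u)<s(v)$, or $s(u)=s(v)$ and $u \prec v$ in their common fiber. An AP triple in $S$ is $(x,y,z)$ with $x<y<z$ in $S$ and $z = 2y-x$. An arrangement avoids monotone $3$-term arithmetic progressions if for no AP triple $(x,y,z)$ do its members occur in the position order $x,y,z$ or in the position order $z,y,x$. $S$ is $3$-permutable if there is a bijection $\pi\colon\mathbb{N}\to S$ (a permutation of order type $\omega$) avoiding monotone $3$-term arithmetic progressions. *)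

theory Defs
  imports Main "HOL-Library.FuncSet"
begin

text \<open>
  The natural numbers of the source start at 1; they are rendered as the subset
  \<open>{1..}\<close> of \<open>nat\<close>, and likewise the index set of stages.
  All orders are strict: \<open>(u, v) \<in> r\<close> reads ``\<open>u\<close> comes before \<open>v\<close>''.
\<close>

definition strict_order_of :: "nat set \<Rightarrow> nat rel \<Rightarrow> bool" where
  "strict_order_of A r \<longleftrightarrow> r \<subseteq> A \<times> A \<and> strict_linear_order_on A r"

text \<open>Since \<open>x < y\<close>, the subtraction below never truncates.\<close>

definition AP_triple :: "nat set \<Rightarrow> nat \<Rightarrow> nat \<Rightarrow> nat \<Rightarrow> bool" where
  "AP_triple S x y z \<longleftrightarrow>
     x \<in> S \<and> y \<in> S \<and> z \<in> S \<and> x < y \<and> y < z \<and> z = 2 * y - x"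

text \<open>
  An arrangement of \<open>S\<close> is given by its (strict) precedence relation \<open>T\<close>,
  so that arrangements of arbitrary order type are covered.
\<close>

definition occurs_monotonically :: "nat rel \<Rightarrow> nat \<Rightarrow> nat \<Rightarrow> nat \<Rightarrow> bool" where
  "occurs_monotonically T x y z \<longleftrightarrow>
     ((x, y) \<in> T \<and> (y, z) \<in> T) \<or> ((z, y) \<in> T \<and> (y, x) \<in> T)"

definition avoids_monotone_3AP :: "nat set \<Rightarrow> nat rel \<Rightarrow> bool" where
  "avoids_monotone_3AP S T \<longleftrightarrow>
     (\<forall>x y z. AP_triple S x y z \<longrightarrow> \<not> occurs_monotonically T x y z)"

definition permutation_order :: "(nat \<Rightarrow> nat) \<Rightarrow> nat rel" where
  "permutation_order p = {(p i, p j) | i j. 1 \<le> i \<and> i < j}"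

definition three_permutable :: "nat set \<Rightarrow> bool" where
  "three_permutable S \<longleftrightarrow>
     (\<exists>p. bij_betw p {1..} S \<and> avoids_monotone_3AP S (permutation_order p))"

definition fiber :: "nat set \<Rightarrow> (nat \<Rightarrow> nat) \<Rightarrow> nat \<Rightarrow> nat set" where
  "fiber S s k = {u \<in> S. s u = k}"

text \<open>Only the values of \<open>s\<close> on \<open>S\<close> matter.\<close>

definition stage_function :: "nat set \<Rightarrow> (nat \<Rightarrow> nat) \<Rightarrow> bool" where
  "stage_function S s \<longleftrightarrow> s \<in> S \<rightarrow> {1..} \<and> (\<forall>k\<in>{1..}. finite (fiber S s k))"

text \<open>
  \<open>R k\<close> is the order on the fiber over \<open>k\<close>; on an empty fiber this forces \<open>R k = {}\<close>.
\<close>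

definition fiber_orders :: "nat set \<Rightarrow> (nat \<Rightarrow> nat) \<Rightarrow> (nat \<Rightarrow> nat rel) \<Rightarrow> bool" where
  "fiber_orders S s R \<longleftrightarrow> (\<forall>k\<in>{1..}. strict_order_of (fiber S s k) (R k))"

definition concatenation :: "nat set \<Rightarrow> (nat \<Rightarrow> nat) \<Rightarrow> (nat \<Rightarrow> nat rel) \<Rightarrow> nat rel" where
  "concatenation S s R =
     {(u, v). u \<in> S \<and> v \<in> S \<and> (s u < s v \<or> (s u = s v \<and> (u, v) \<in> R (s u)))}"

lemma strict_order_of_concatenation:
  assumes "stage_function S s" "fiber_orders S s R"
  shows "strict_order_of S (concatenation S s R)"
proof -
  have o: "strict_order_of (fiber S s (s u)) (R (s u))" if "u \<in> S" for u
    using assms that by (auto simp: stage_function_def fiber_orders_def)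
  have tr: "(u, w) \<in> R (s u)" if "u \<in> S" "(u, v) \<in> R (s u)" "(v, w) \<in> R (s u)" for u v w
    using o[OF that(1)] that(2,3)
    unfolding strict_order_of_def strict_linear_order_on_def trans_def by blast
  have ir: "(u, u) \<notin> R (s u)" if "u \<in> S" for u
    using o[OF that] by (auto simp: strict_order_of_def strict_linear_order_on_def irrefl_def)
  have tot: "(u, v) \<in> R (s u) \<or> (v, u) \<in> R (s u)"
    if "u \<in> S" "v \<in> S" "u \<noteq> v" "s u = s v" for u v
    using o[OF that(1)] that
    by (auto simp: strict_order_of_def strict_linear_order_on_def total_on_def fiber_def)
  have "trans (concatenation S s R)"
    unfolding concatenation_def by (rule transI) (auto intro: tr)
  moreover have "irrefl (concatenation S s R)"
    using ir by (auto simp: irrefl_def concatenation_def)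
  moreover have "total_on S (concatenation S s R)"
    unfolding total_on_def concatenation_def using tot by (fastforce simp: linorder_neq_iff)
  ultimately show ?thesis
    by (auto simp: strict_order_of_def strict_linear_order_on_def concatenation_def)
qed

definition no_monotone_stages :: "nat set \<Rightarrow> (nat \<Rightarrow> nat) \<Rightarrow> bool" where
  "no_monotone_stages S s \<longleftrightarrow>
     (\<forall>x y z. AP_triple S x y z \<longrightarrow>
        \<not> (s x < s y \<and> s y < s z) \<and> \<not> (s z < s y \<and> s y < s x))"

definition forced_pairs :: "nat set \<Rightarrow> (nat \<Rightarrow> nat) \<Rightarrow> (nat \<Rightarrow> nat rel) \<Rightarrow> bool" where
  "forced_pairs S s R \<longleftrightarrow>
     (\<forall>x y z. AP_triple S x y z \<longrightarrow>
        (s x < s y \<and> s y = s z \<longrightarrow> (z, y) \<in> R (s y)) \<and>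
        (s z < s y \<and> s y = s x \<longrightarrow> (x, y) \<in> R (s y)) \<and>
        (s x = s y \<and> s y < s z \<longrightarrow> (y, x) \<in> R (s y)) \<and>
        (s y = s z \<and> s z < s x \<longrightarrow> (y, z) \<in> R (s y)) \<and>
        (s x = s y \<and> s y = s z \<longrightarrow>
           \<not> ((x, y) \<in> R (s y) \<and> (y, z) \<in> R (s y)) \<and>
           \<not> ((z, y) \<in> R (s y) \<and> (y, x) \<in> R (s y))))"

text \<open>
  The part of \<open>forced_pairs\<close> that concerns the fiber over the single stage \<open>k\<close>:
  a condition on one relation \<open>r\<close>, the order of that fiber, and on no other fiber order.
\<close>

definition forced_pairs_at :: "nat set \<Rightarrow> (nat \<Rightarrow> nat) \<Rightarrow> nat \<Rightarrow> nat rel \<Rightarrow> bool" where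
  "forced_pairs_at S s k r \<longleftrightarrow>
     (\<forall>x y z. AP_triple S x y z \<longrightarrow>
        (s x < k \<and> s y = k \<and> s z = k \<longrightarrow> (z, y) \<in> r) \<and>
        (s z < k \<and> s y = k \<and> s x = k \<longrightarrow> (x, y) \<in> r) \<and>
        (s x = k \<and> s y = k \<and> k < s z \<longrightarrow> (y, x) \<in> r) \<and>
        (s y = k \<and> s z = k \<and> k < s x \<longrightarrow> (y, z) \<in> r) \<and>
        (s x = k \<and> s y = k \<and> s z = k \<longrightarrow>
           \<not> ((x, y) \<in> r \<and> (y, z) \<in> r) \<and> \<not> ((z, y) \<in> r \<and> (y, x) \<in> r)))"

end

theory Submission
  imports Defs "HOL-Library.Infinite_Set"
begin

text \<open>
  In the concatenation two elements of different stages compare as their stages do, so a case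
  distinction on the relative stages of \<open>x, y\<close> and of \<open>y, z\<close> settles the criterion triple by
  triple. For the converse direction of the second claim, finiteness of the fibers gives every
  element of the concatenation only finitely many predecessors, hence the arrangement has
  order type \<open>\<omega>\<close> and is a permutation; conversely the position in a permutation is a stage
  function with singleton fibers.
\<close>

lemma strict_order_ofD:
  assumes "strict_order_of A r"
  shows strict_order_of_subset: "r \<subseteq> A \<times> A"
    and strict_order_of_not_iff:
      "u \<in> A \<Longrightarrow> v \<in> A \<Longrightarrow> u \<noteq> v \<Longrightarrow> (u, v) \<notin> r \<longleftrightarrow> (v, u) \<in> r"
    and strict_order_of_trans: "(u, v) \<in> r \<Longrightarrow> (v, w) \<in> r \<Longrightarrow> (u, w) \<in> r"
    and strict_order_of_irrefl: "(u, u) \<notin> r"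
  using assms
  unfolding strict_order_of_def strict_linear_order_on_def trans_def irrefl_def total_on_def
  by blast+

lemma fiber_order_not_iff:
  assumes "stage_function S s" "fiber_orders S s R"
    and "u \<in> S" "v \<in> S" "u \<noteq> v" "s u = s v"
  shows "(u, v) \<notin> R (s v) \<longleftrightarrow> (v, u) \<in> R (s v)"
proof (rule strict_order_of_not_iff)
  show "strict_order_of (fiber S s (s v)) (R (s v))"
    using assms by (auto simp: stage_function_def fiber_orders_def)
qed (use assms in \<open>auto simp: fiber_def\<close>)

lemma in_concatenation_iff:
  assumes "u \<in> S" "v \<in> S"
  shows "(u, v) \<in> concatenation S s R \<longleftrightarrow> s u < s v \<or> s u = s v \<and> (u, v) \<in> R (s v)"
  using assms by (auto simp: concatenation_def)

text \<open>If exactly one neighbour shares the stage of \<open>y\<close>, the other one already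
  fixes the only direction in which the triple could be monotone. Avoiding it is a negated fiber
  comparison, which totality turns into the reversed pair of (B).\<close>

lemma not_occurs_monotonically_concatenation_iff:
  assumes "stage_function S s" "fiber_orders S s R" and AP: "AP_triple S x y z"
  shows "\<not> occurs_monotonically (concatenation S s R) x y z \<longleftrightarrow>
    (\<not> (s x < s y \<and> s y < s z) \<and> \<not> (s z < s y \<and> s y < s x)) \<and>
    (s x < s y \<and> s y = s z \<longrightarrow> (z, y) \<in> R (s y)) \<and>
    (s z < s y \<and> s y = s x \<longrightarrow> (x, y) \<in> R (s y)) \<and>
    (s x = s y \<and> s y < s z \<longrightarrow> (y, x) \<in> R (s y)) \<and>
    (s y = s z \<and> s z < s x \<longrightarrow> (y, z) \<in> R (s y)) \<and>
    (s x = s y \<and> s y = s z \<longrightarrow>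
       \<not> ((x, y) \<in> R (s y) \<and> (y, z) \<in> R (s y)) \<and>
       \<not> ((z, y) \<in> R (s y) \<and> (y, x) \<in> R (s y)))"
proof -
  have S: "x \<in> S" "y \<in> S" "z \<in> S" "x \<noteq> y" "z \<noteq> y"
    using AP by (auto simp: AP_triple_def)
  note flip = fiber_order_not_iff[OF assms(1,2)]
  \<comment> \<open>Monotonicity compares \<open>y\<close> with \<open>x\<close> and with
    \<open>z\<close> only, so totality is invoked just for these two pairs.\<close>
  have xy: "s x = s y \<Longrightarrow> (y, x) \<in> R (s y) \<longleftrightarrow> (x, y) \<notin> R (s y)"
    and zy: "s z = s y \<Longrightarrow> (y, z) \<in> R (s y) \<longleftrightarrow> (z, y) \<notin> R (s y)"
    using flip[of x y] flip[of z y] S by auto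
  consider "s x < s y" | "s x = s y" | "s x > s y" by linarith
  then show ?thesis
    by cases (cases "s z" "s y" rule: linorder_cases;
      auto simp: occurs_monotonically_def in_concatenation_iff S dest: xy zy)+
qed

lemma avoids_monotone_3AP_concatenation_iff:
  assumes "stage_function S s" "fiber_orders S s R"
  shows "avoids_monotone_3AP S (concatenation S s R) \<longleftrightarrow>
    no_monotone_stages S s \<and> forced_pairs S s R"
  using not_occurs_monotonically_concatenation_iff[OF assms]
  unfolding avoids_monotone_3AP_def no_monotone_stages_def forced_pairs_def
  by (smt (verit))

text \<open>The stages alone put \<open>y\<close> before both other terms or after both, hence never
  between them.\<close>

lemma middle_stage_extreme_imp_not_occurs_monotonically:
  assumes "AP_triple S x y z"
    and "s y < s x \<and> s y < s z \<or> s x < s y \<and> s z < s y"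
  shows "\<not> occurs_monotonically (concatenation S s R) x y z"
  using assms by (auto simp: AP_triple_def occurs_monotonically_def in_concatenation_iff)

text \<open>Counting predecessors embeds the order into the natural numbers; listing the infinite
  image increasingly and pulling back yields the permutation.\<close>

lemma permutation_order_of_finite_predecessors:
  assumes "infinite S" and T: "strict_order_of S T" and fin: "\<And>v. finite {u. (u, v) \<in> T}"
  obtains p where "bij_betw p {1..} S" "permutation_order p = T"
proof -
  note T = strict_order_ofD[OF T]
  define g where "g v = card {u. (u, v) \<in> T}" for v
  \<comment> \<open>By transitivity every predecessor of \<open>u\<close> precedes \<open>v\<close>;
    the inclusion is proper because \<open>u\<close> precedes \<open>v\<close> but not
    itself.\<close>
  have mono: "g u < g v" if "(u, v) \<in> T" for u v
    unfolding g_def using that T(3)[OF _ that] T(4)[of u]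
    by (intro psubset_card_mono[OF fin]) blast
  have less_iff: "g u < g v \<longleftrightarrow> (u, v) \<in> T" if "u \<in> S" "v \<in> S" for u v
    using mono[of u v] mono[of v u] T(2)[OF that] by (cases "u = v") auto
  have inj: "inj_on g S"
    using mono T(2) by (metis inj_onI less_irrefl)
  define I where "I = g ` S"
  have I: "infinite I"
    using assms(1) inj by (simp add: I_def finite_image_iff)
  \<comment> \<open>Enumerating \<open>I\<close> makes it unnecessary to show that the ranks fill
    all of \<open>nat\<close>. The shift reconciles positions starting at 1 with
    \<open>enumerate\<close>, which starts at 0.\<close>
  define p where "p = inv_into S g \<circ> enumerate I \<circ> (\<lambda>i. i - 1)"
  have "bij_betw (\<lambda>i::nat. i - 1) {1..} UNIV"
    by (rule bij_betw_byWitness[where f' = Suc]) auto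
  moreover have "bij_betw (enumerate I) UNIV I"
    using I by (rule bij_enumerate)
  moreover have "bij_betw (inv_into S g) I S"
    unfolding I_def using inj by (intro bij_betw_inv_into) (simp add: bij_betw_def)
  ultimately have bij: "bij_betw p {1..} S"
    unfolding p_def by (intro bij_betw_trans)
  have gp: "g (p i) = enumerate I (i - 1)" for i
    using enumerate_in_set[OF I, of "i - 1"] by (simp add: p_def I_def f_inv_into_f)
  have pS: "p i \<in> S" if "1 \<le> i" for i
    using bij that by (auto simp: bij_betw_def)
  have order: "(p i, p j) \<in> T \<longleftrightarrow> i < j" if "1 \<le> i" "1 \<le> j" for i j
  proof -
    have "(p i, p j) \<in> T \<longleftrightarrow> i - 1 < j - 1"
      using I that by (simp add: less_iff[symmetric] pS gp enumerate_mono_iff)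
    \<comment> \<open>The bounds matter: the truncated subtraction would identify positions 0 and
      1.\<close>
    then show ?thesis using that by linarith
  qed
  have "permutation_order p = T"
  proof (intro equalityI subrelI)
    fix u v assume "(u, v) \<in> permutation_order p"
    then show "(u, v) \<in> T" by (auto simp: permutation_order_def order)
  next
    fix u v assume uv: "(u, v) \<in> T"
    then obtain i j where "1 \<le> i" "1 \<le> j" "u = p i" "v = p j"
      using T(1) bij by (fastforce simp: bij_betw_def)
    with uv show "(u, v) \<in> permutation_order p"
      by (auto simp: permutation_order_def order)
  qed
  with bij show thesis by (rule that)
qed

text \<open>Predecessors of \<open>v\<close> have stage at most \<open>s v\<close>, so they lie in
  finitely many finite fibers.\<close>

lemma finite_predecessors_concatenation:
  assumes "stage_function S s"
  shows "finite {u. (u, v) \<in> concatenation S s R}"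
proof (rule finite_subset)
  show "{u. (u, v) \<in> concatenation S s R} \<subseteq> (\<Union>k\<in>{1..s v}. fiber S s k)"
    using assms by (force simp: concatenation_def fiber_def stage_function_def Pi_iff)
  show "finite (\<Union>k\<in>{1..s v}. fiber S s k)"
    using assms by (auto simp: stage_function_def)
qed

lemma permutation_order_eq_concatenation:
  assumes bij: "bij_betw p {1..} S"
  obtains s R where "stage_function S s" "fiber_orders S s R"
    "concatenation S s R = permutation_order p"
proof
  define s where "s = inv_into {1..} p"
  have s: "s (p i) = i" if "1 \<le> i" for i
    using bij that by (simp add: s_def bij_betw_inv_into_left)
  have S: "S = p ` {1..}"
    using bij by (simp add: bij_betw_def)
  have fiber: "fiber S s k = {p k}" if "k \<in> {1..}" for k
    using that by (auto simp: fiber_def S s)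
  have "s \<in> S \<rightarrow> {1..}"
    using s by (auto simp: S)
  then show "stage_function S s"
    by (simp add: stage_function_def fiber)
  \<comment> \<open>The only strict order on a singleton is empty, so all comparisons come from the
    stages.\<close>
  show "fiber_orders S s (\<lambda>_. {})"
    by (simp add: fiber_orders_def fiber strict_order_of_def strict_linear_order_on_def)
  show "concatenation S s (\<lambda>_. {}) = permutation_order p"
    by (fastforce simp: concatenation_def permutation_order_def S s)
qed

text \<open>For infinite \<open>S\<close>, permutations and concatenations produce the same
  precedence relations.\<close>

lemma three_permutable_iff:
  assumes "infinite S"
  shows "three_permutable S \<longleftrightarrow>
    (\<exists>s R. stage_function S s \<and> fiber_orders S s R \<and>
       avoids_monotone_3AP S (concatenation S s R))"
proof
  assume "three_permutable S"
  then show "\<exists>s R. stage_function S s \<and> fiber_orders S s R \<and>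
      avoids_monotone_3AP S (concatenation S s R)"
    unfolding three_permutable_def by (metis permutation_order_eq_concatenation)
next
  assume "\<exists>s R. stage_function S s \<and> fiber_orders S s R \<and>
    avoids_monotone_3AP S (concatenation S s R)"
  then obtain s R where s: "stage_function S s" and R: "fiber_orders S s R"
    and avoids: "avoids_monotone_3AP S (concatenation S s R)"
    by blast
  obtain p where "bij_betw p {1..} S" "permutation_order p = concatenation S s R"
    using permutation_order_of_finite_predecessors[OF assms
        strict_order_of_concatenation[OF s R] finite_predecessors_concatenation[OF s]] .
  with avoids show "three_permutable S"
    unfolding three_permutable_def by metis
qed

text \<open>Every clause constrains only the fiber containing the middle term, so the triples can be
  sorted by \<open>k = s y\<close>.\<close>

lemma forced_pairs_iff_forced_pairs_at:
  assumes "stage_function S s"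
  shows "forced_pairs S s R \<longleftrightarrow> (\<forall>k\<in>{1..}. forced_pairs_at S s k (R k))"
proof
  assume "forced_pairs S s R"
  then show "\<forall>k\<in>{1..}. forced_pairs_at S s k (R k)"
    unfolding forced_pairs_def forced_pairs_at_def by (smt (verit))
next
  assume at: "\<forall>k\<in>{1..}. forced_pairs_at S s k (R k)"
  have "forced_pairs_at S s (s y) (R (s y))" if "AP_triple S x y z" for x y z
    using assms at that by (auto simp: stage_function_def AP_triple_def)
  then show "forced_pairs S s R"
    unfolding forced_pairs_def forced_pairs_at_def by (smt (verit))
qed

text \<open>Independence is expressed as a product: admissible orders may be chosen stage by stage.
  The value \<open>R 0\<close> is unrestricted on both sides.\<close>

lemma forced_fiber_orders_eq_Pi:
  assumes "stage_function S s"
  shows "{R. fiber_orders S s R \<and> forced_pairs S s R} =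
    (\<Pi> k\<in>{1..}. {r. strict_order_of (fiber S s k) r \<and> forced_pairs_at S s k r})"
  by (auto simp: forced_pairs_iff_forced_pairs_at[OF assms] fiber_orders_def Pi_iff)

theorem theorem32:
  fixes S :: "nat set"
  assumes "infinite S" and "S \<subseteq> {1..}"
  shows "(\<forall>s R. stage_function S s \<and> fiber_orders S s R \<longrightarrow>
            (avoids_monotone_3AP S (concatenation S s R) \<longleftrightarrow>
               no_monotone_stages S s \<and> forced_pairs S s R) \<and>
            (\<forall>x y z. AP_triple S x y z \<and>
                 ((s y < s x \<and> s y < s z) \<or> (s x < s y \<and> s z < s y)) \<longrightarrow>
               \<not> occurs_monotonically (concatenation S s R) x y z))
       \<and> (three_permutable S \<longleftrightarrow>
            (\<exists>s R. stage_function S s \<and> fiber_orders S s R \<and>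
               no_monotone_stages S s \<and> forced_pairs S s R))
       \<and> (\<forall>s. stage_function S s \<longrightarrow>
            (\<forall>R. fiber_orders S s R \<longrightarrow>
               (forced_pairs S s R \<longleftrightarrow> (\<forall>k\<in>{1..}. forced_pairs_at S s k (R k)))) \<and>
            {R. fiber_orders S s R \<and> forced_pairs S s R} =
              (\<Pi> k\<in>{1..}. {r. strict_order_of (fiber S s k) r \<and> forced_pairs_at S s k r}))"
proof (intro conjI allI impI; (elim conjE)?)
  show "three_permutable S \<longleftrightarrow>
    (\<exists>s R. stage_function S s \<and> fiber_orders S s R \<and>
       no_monotone_stages S s \<and> forced_pairs S s R)"
    using three_permutable_iff[OF assms(1)] avoids_monotone_3AP_concatenation_iff by metis
qed (rule avoids_monotone_3AP_concatenation_iff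
    middle_stage_extreme_imp_not_occurs_monotonically forced_pairs_iff_forced_pairs_at
    forced_fiber_orders_eq_Pi; assumption)+

end
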